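(* Consider a general-expiration stream of $n$ items where item $i$ has weight $w_i\ge1$ and total weight $W=\sum_i w_i\ge2$, and let $k\in\mathbb{N}$, $\delta\in(0,1)$. Running $k$ independent copies of a sample-thinned sketch for weighted sampling (described in the context) one can retrieve, for any future time $t$, $k$ with-replacement samples from the active set $A(t)$, each sample equal to item $i\in A(t)$ with probability $w_i/\sum_{j\in A(t)}w_j$. With probability at least $1-\delta$, the sketch stores at most $\mathcal{O}(k\log(W/\delta))$ items during the execution.
   Context: General expiration stream: items arrive in order, each with insertion time $S$ (non-decreasing) and arbitrary expiration time $E>S$; active at time $t$ iff $S\le t<E$; for current time $t_0$ and future time $t\ge t_0$, $A(t)$ is the set of items already inserted by $t_0$ that are active at $t$ (assuming no further insertions). Sample-thinned sketch for weighted sampling (one copy): on insertion of item $i$, assign an independent priority $u_i\sim\mathrm{Exp}(w_i)$ (exponential with rate $w_i$) and store it; expired items are removed; a stored item $x_j$ is removed if some other stored item has expiration time at least $E(x_j)$ and priority smaller than $u_j$. On a query for future time $t$, report the stored item with smallest priority among those with expiration time after $t$. *)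

theory Defs
  imports "HOL-Probability.Probability"
begin

text \<open>
  The items of a stream are numbered \<open>0, \<dots>, n - 1\<close> in order of arrival; \<open>S i\<close> and \<open>E i\<close>
  are the insertion and expiration time of item \<open>i\<close>.
\<close>

definition expiration_stream :: "nat \<Rightarrow> (nat \<Rightarrow> real) \<Rightarrow> (nat \<Rightarrow> real) \<Rightarrow> bool" where
  "expiration_stream n S E \<longleftrightarrow> mono_on {..<n} S \<and> (\<forall>i<n. S i < E i)"

text \<open>
  A moment of the execution is a pair \<open>(m, t0)\<close>: the current time is \<open>t0\<close> and exactly the first
  \<open>m\<close> items have been inserted. The number \<open>m\<close> is not a function of \<open>t0\<close> because several items
  may arrive at the same time; the states between such arrivals are moments as well.
\<close>

definition moment :: "nat \<Rightarrow> (nat \<Rightarrow> real) \<Rightarrow> nat \<Rightarrow> real \<Rightarrow> bool" where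
  "moment n S m t0 \<longleftrightarrow> m \<le> n \<and> (\<forall>i<m. S i \<le> t0) \<and> (\<forall>i. m \<le> i \<and> i < n \<longrightarrow> t0 \<le> S i)"

definition active :: "(nat \<Rightarrow> real) \<Rightarrow> (nat \<Rightarrow> real) \<Rightarrow> nat \<Rightarrow> real \<Rightarrow> nat set" where
  "active S E m t = {i. i < m \<and> S i \<le> t \<and> t < E i}"

definition unexpired :: "(nat \<Rightarrow> real) \<Rightarrow> real \<Rightarrow> nat set \<Rightarrow> nat set" where
  "unexpired E t X = {x \<in> X. t < E x}"

definition thin :: "(nat \<Rightarrow> real) \<Rightarrow> (nat \<Rightarrow> real) \<Rightarrow> nat set \<Rightarrow> nat set" where
  "thin E p X = {x \<in> X. \<not> (\<exists>y\<in>X. y \<noteq> x \<and> E x \<le> E y \<and> p y < p x)}"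

text \<open>
  One copy of the sketch, run with priorities \<open>p\<close>: \<open>sketch S E p m\<close> is the set of stored items
  right after the first \<open>m\<close> insertions, and \<open>stored S E p m t0\<close> the set still stored at the
  moment \<open>(m, t0)\<close>. Expirations alone never make a stored item dominated, so thinning is needed
  only at insertions.
\<close>

primrec sketch :: "(nat \<Rightarrow> real) \<Rightarrow> (nat \<Rightarrow> real) \<Rightarrow> (nat \<Rightarrow> real) \<Rightarrow> nat \<Rightarrow> nat set" where
  "sketch S E p 0 = {}"
| "sketch S E p (Suc m) = thin E p (insert m (unexpired E (S m) (sketch S E p m)))"

definition stored ::
  "(nat \<Rightarrow> real) \<Rightarrow> (nat \<Rightarrow> real) \<Rightarrow> (nat \<Rightarrow> real) \<Rightarrow> nat \<Rightarrow> real \<Rightarrow> nat set" where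
  "stored S E p m t0 = unexpired E t0 (sketch S E p m)"

text \<open>
  The result of a query for time \<open>t\<close> is unspecified if no stored item expires after \<open>t\<close>; among
  items of equal priority (a null event) the choice is arbitrary.
\<close>

definition query ::
  "(nat \<Rightarrow> real) \<Rightarrow> (nat \<Rightarrow> real) \<Rightarrow> (nat \<Rightarrow> real) \<Rightarrow> nat \<Rightarrow> real \<Rightarrow> real \<Rightarrow> nat" where
  "query S E p m t0 t = arg_min p (\<lambda>x. x \<in> stored S E p m t0 \<and> t < E x)"

text \<open>
  The random choices of \<open>k\<close> independent copies: the coordinate \<open>(c, i)\<close> of the product is the
  priority of item \<open>i\<close> in copy \<open>c\<close>.
\<close>

definition priorities :: "nat \<Rightarrow> nat \<Rightarrow> (nat \<Rightarrow> real) \<Rightarrow> (nat \<times> nat \<Rightarrow> real) measure" where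
  "priorities k n w =
     PiM ({..<k} \<times> {..<n}) (\<lambda>(c, i). density lborel (exponential_density (w i)))"

definition copy :: "nat \<Rightarrow> (nat \<times> nat \<Rightarrow> real) \<Rightarrow> nat \<Rightarrow> real" where
  "copy c \<omega> i = \<omega> (c, i)"

lemma prob_space_priorities:
  assumes "\<And>i. i < n \<Longrightarrow> 0 < w i"
  shows "prob_space (priorities k n w)"
  unfolding priorities_def
  by (rule prob_space_PiM) (use assms in \<open>auto intro: prob_space_exponential_density\<close>)

end

theory Submission
  imports Defs
begin

text \<open>
  Thinning commutes with expiration and with insertion, so the stored set is the thinning of all
  unexpired items, and a query returns an item of least priority among the active ones. Item
  \<open>i\<close> has least priority with probability at most \<open>w\<^sub>i / \<Sum>w\<close>; since these bounds
  sum to \<open>1\<close>, and some item is always returned, equality holds, whatever happens on ties.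

  For the size, let \<open>A\<close> be a set of items and \<open>N\<close> the size of its thinning, and write \<open>w(A)\<close> for its total weight.
  Adding an item of smallest expiration time increases \<open>N\<close> only if its priority is a new
  minimum. Conditioning on that priority gives, by induction, a bound
  \<open>(1 + w(A)) e\<^bsup>- t w(A)\<^esup>\<close> for the expectation of \<open>2\<^bsup>N\<^esup>\<close> on the event
  that all priorities are at least \<open>t\<close>. For \<open>t = 0\<close> and \<open>k\<close> independent copies this is
  \<open>(1 + w(A))\<^bsup>k\<^esup>\<close>. Markov's inequality bounds the failure probability at one moment by
  \<open>\<delta> / W\<close>, and only the at most \<open>W\<close> moments right after an insertion matter.
\<close>

section \<open>Deterministic behaviour of thinning and of a single copy\<close>

lemma finite_thin [simp]: "finite A \<Longrightarrow> finite (thin E p A)"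
  by (simp add: thin_def)

lemma thin_subset: "thin E p A \<subseteq> A"
  by (auto simp: thin_def)

text \<open>A dominating item expires no earlier than the item it dominates, so it is still present
  whenever the latter is.\<close>

lemma unexpired_thin: "unexpired E t (thin E p A) = thin E p (unexpired E t A)"
  by (fastforce simp: unexpired_def thin_def)

text \<open>Among the items of \<open>A\<close> expiring no earlier than \<open>x\<close>, one of
  least priority survives: anything that dominated it would lie in the same set with a smaller
  priority. Thus survivors can replace discarded items as witnesses of domination.\<close>

lemma dominated_by_thin:
  assumes "finite A" "y \<in> A" "E x \<le> E y" "p y < p x"
  obtains z where "z \<in> thin E p A" "E x \<le> E z" "p z < p x"
proof -
  let ?D = "{z \<in> A. E x \<le> E z}"
  have D: "finite ?D" "y \<in> ?D" using assms by auto
  then obtain z where z: "z \<in> ?D" and min: "\<And>v. v \<in> ?D \<Longrightarrow> p z \<le> p v"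
    using ex_is_arg_min_if_finite[of ?D p] by (auto simp: is_arg_min_linorder)
  have "z \<in> thin E p A"
    using z min by (fastforce simp: thin_def)
  moreover have "p z < p x" using min[OF D(2)] assms(4) by simp
  ultimately show thesis using z that by blast
qed

text \<open>Discarding items early loses nothing: whatever a discarded item dominates, the new item
  included, is also dominated by a survivor.\<close>

lemma thin_insert_thin:
  assumes "finite B"
  shows "thin E p (insert m (thin E p B)) = thin E p (insert m B)"
proof (rule set_eqI)
  fix x
  have thin_iff: "x \<in> thin E p X \<longleftrightarrow> x \<in> X \<and> \<not> (\<exists>y\<in>X. E x \<le> E y \<and> p y < p x)" for X
    by (auto simp: thin_def)
  have "(\<exists>y\<in>thin E p B. E x \<le> E y \<and> p y < p x) \<longleftrightarrow> (\<exists>y\<in>B. E x \<le> E y \<and> p y < p x)"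
    using dominated_by_thin[OF assms, of _ E x p] thin_subset[of E p B] by blast
  then show "x \<in> thin E p (insert m (thin E p B)) \<longleftrightarrow> x \<in> thin E p (insert m B)"
    using thin_iff[of B] by (simp add: thin_iff) blast
qed

text \<open>By induction over insertions. As \<open>S\<close> is non-decreasing, expiring at the new
  insertion time subsumes all earlier expirations; the new item itself is unexpired because
  \<open>S i < E i\<close>.\<close>

lemma sketch_Suc_eq_thin:
  assumes "expiration_stream n S E" "Suc m \<le> n"
  shows "sketch S E p (Suc m) = thin E p (unexpired E (S m) {..<Suc m})"
  using assms(2)
proof (induction m)
  case 0
  then have "unexpired E (S 0) {..<Suc 0} = {0}"
    using assms(1) by (auto simp: expiration_stream_def unexpired_def)
  then show ?case by (simp add: unexpired_def)
next
  case (Suc m)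
  let ?B = "unexpired E (S (Suc m)) {..<Suc m}"
  have le: "S m \<le> S (Suc m)" and new: "S (Suc m) < E (Suc m)"
    using assms(1) Suc.prems by (auto simp: expiration_stream_def mono_on_def)
  have "unexpired E (S (Suc m)) (sketch S E p (Suc m)) = thin E p ?B"
  proof -
    have "unexpired E (S (Suc m)) (unexpired E (S m) {..<Suc m}) = ?B"
      using le by (auto simp: unexpired_def)
    then show ?thesis using Suc by (simp del: sketch.simps add: unexpired_thin)
  qed
  moreover have "insert (Suc m) ?B = unexpired E (S (Suc m)) {..<Suc (Suc m)}"
    using new by (auto simp: unexpired_def less_Suc_eq)
  moreover have "finite ?B" by (simp add: unexpired_def)
  ultimately show ?case
    using thin_insert_thin[of ?B] by (simp add: sketch.simps(2)[of S E p "Suc m"] del: sketch.simps)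
qed

lemma stored_eq_thin:
  assumes "expiration_stream n S E" "moment n S m t0"
  shows "stored S E p m t0 = thin E p (unexpired E t0 {..<m})"
proof (cases m)
  case 0
  then show ?thesis by (simp add: stored_def unexpired_def thin_def)
next
  case (Suc l)
  then have le: "S l \<le> t0" "Suc l \<le> n" using assms(2) by (auto simp: moment_def)
  then have "unexpired E t0 (unexpired E (S l) {..<m}) = unexpired E t0 {..<m}"
    by (auto simp: unexpired_def)
  then show ?thesis
    using sketch_Suc_eq_thin[OF assms(1) le(2), of p]
    by (simp add: stored_def Suc unexpired_thin del: sketch.simps)
qed

text \<open>Every discarded item has a survivor of strictly smaller priority. The two predicates
  agree even on ties, so the choice operator behind \<open>arg_min\<close> picks the same item from
  both sets.\<close>

lemma is_arg_min_thin_iff: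
  assumes "finite A"
  shows "is_arg_min p (\<lambda>x. x \<in> thin E p A) = is_arg_min p (\<lambda>x. x \<in> A)"
proof (rule ext)
  fix x
  have "(\<forall>y\<in>thin E p A. p x \<le> p y) \<longleftrightarrow> (\<forall>y\<in>A. p x \<le> p y)"
  proof safe
    fix y assume *: "\<forall>y\<in>thin E p A. p x \<le> p y" "y \<in> A"
    show "p x \<le> p y"
    proof (cases "y \<in> thin E p A")
      case False
      with *(2) obtain v where "v \<in> A" "E y \<le> E v" "p v < p y" by (auto simp: thin_def)
      with assms obtain z where "z \<in> thin E p A" "p z < p y" by (rule dominated_by_thin)
      with * show ?thesis by force
    qed (use * in auto)
  qed (auto simp: thin_def)
  then show "is_arg_min p (\<lambda>x. x \<in> thin E p A) x = is_arg_min p (\<lambda>x. x \<in> A) x"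
    using thin_subset[of E p A] by (auto simp: is_arg_min_linorder thin_def)
qed

lemma query_eq_arg_min:
  assumes "expiration_stream n S E" "moment n S m t0" "t0 \<le> t"
  shows "query S E p m t0 t = arg_min p (\<lambda>x. x \<in> active S E m t)"
proof -
  have "unexpired E t (unexpired E t0 {..<m}) = active S E m t"
    using assms(2,3) by (auto simp: unexpired_def active_def moment_def)
  then have "unexpired E t (stored S E p m t0) = thin E p (active S E m t)"
    by (simp add: stored_eq_thin[OF assms(1,2)] unexpired_thin)
  then have "(\<lambda>x. x \<in> stored S E p m t0 \<and> t < E x) = (\<lambda>x. x \<in> thin E p (active S E m t))"
    by (auto simp: unexpired_def set_eq_iff fun_eq_iff)
  then show ?thesis
    by (simp add: query_def arg_min_def is_arg_min_thin_iff active_def)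
qed

text \<open>Between insertions items only leave. This reduces the uncountably many moments to those
  right after an insertion.\<close>

lemma card_stored_le:
  assumes "expiration_stream n S E" "moment n S (Suc l) t0"
  shows "card (stored S E p (Suc l) t0) \<le> card (thin E p (unexpired E (S l) {..<Suc l}))"
proof -
  have "S l \<le> t0" using assms(2) by (simp add: moment_def)
  then have "unexpired E t0 {..<Suc l} = unexpired E t0 (unexpired E (S l) {..<Suc l})"
    by (auto simp: unexpired_def)
  then have "stored S E p (Suc l) t0 = unexpired E t0 (thin E p (unexpired E (S l) {..<Suc l}))"
    by (simp add: stored_eq_thin[OF assms] unexpired_thin)
  then show ?thesis
    by (intro card_mono) (auto simp: unexpired_def)
qed

lemma thin_cong: "(\<And>x. x \<in> A \<Longrightarrow> p x = q x) \<Longrightarrow> thin E p A = thin E q A"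
  by (auto simp: thin_def)

lemma is_arg_min_cong:
  "(\<And>x. x \<in> A \<Longrightarrow> p x = q x) \<Longrightarrow> is_arg_min p (\<lambda>x. x \<in> A) = is_arg_min q (\<lambda>x. x \<in> A)"
  by (auto simp: is_arg_min_def fun_eq_iff)

text \<open>Every item of \<open>B\<close> expires no earlier than \<open>x\<close>, so
  \<open>x\<close> survives only if no priority in \<open>B\<close> is smaller. If expiration times
  tie, \<open>x\<close> may also remove items, which only helps.\<close>

lemma card_thin_insert_le:
  assumes "finite B" "x \<notin> B" "\<And>y. y \<in> B \<Longrightarrow> E x \<le> E y"
  shows "card (thin E p (insert x B)) \<le> card (thin E p B) + (if \<forall>y\<in>B. p x \<le> p y then 1 else 0)"
proof -
  have "thin E p (insert x B) \<subseteq> thin E p B \<union> (if \<forall>y\<in>B. p x \<le> p y then {x} else {})"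
    using assms(2,3) by (cases "\<forall>y\<in>B. p x \<le> p y") (auto simp: thin_def not_less)
  then have "card (thin E p (insert x B)) \<le> card (thin E p B \<union> (if \<forall>y\<in>B. p x \<le> p y then {x} else {}))"
    using assms by (intro card_mono) auto
  also have "\<dots> \<le> card (thin E p B) + (if \<forall>y\<in>B. p x \<le> p y then 1 else 0)"
    by (rule order.trans[OF card_Un_le]) auto
  finally show ?thesis .
qed

section \<open>Measurability of thinnings and minimisers\<close>

lemma measurable_Collect_finite:
  assumes "finite A" "\<And>x. x \<in> A \<Longrightarrow> Measurable.pred M (P x)"
  shows "(\<lambda>\<omega>. {x \<in> A. P x \<omega>}) \<in> measurable M (count_space UNIV)"
proof -
  \<comment> \<open>The values lie in the finite set \<open>Pow A\<close>, so only preimages of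
    single sets have to be checked.\<close>
  have "(\<lambda>\<omega>. {x \<in> A. P x \<omega>}) \<in> measurable M (count_space (Pow A))"
  proof (subst measurable_count_space_eq2, use assms(1) in simp, intro conjI ballI)
    fix X assume "X \<in> Pow A"
    then have "(\<lambda>\<omega>. {x \<in> A. P x \<omega>}) -` {X} \<inter> space M = {\<omega> \<in> space M. \<forall>x\<in>A. P x \<omega> \<longleftrightarrow> x \<in> X}"
      by auto
    also have "\<dots> \<in> sets M"
      using assms by (intro sets.sets_Collect_finite_All) (auto simp: pred_def)
    finally show "(\<lambda>\<omega>. {x \<in> A. P x \<omega>}) -` {X} \<inter> space M \<in> sets M" .
  qed auto
  then show ?thesis
    by (rule measurable_compose) simp
qed

lemma pred_ball_le:
  fixes f :: "'a \<Rightarrow> real"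
  assumes "finite A" "f \<in> borel_measurable M" "\<And>y. y \<in> A \<Longrightarrow> g y \<in> borel_measurable M"
  shows "Measurable.pred M (\<lambda>\<omega>. \<forall>y\<in>A. f \<omega> \<le> g y \<omega>)"
  unfolding pred_def
proof (rule sets.sets_Collect_finite_All[OF _ assms(1)])
  fix y assume "y \<in> A"
  then have [measurable]: "f \<in> borel_measurable M" "g y \<in> borel_measurable M"
    using assms by auto
  show "{\<omega> \<in> space M. f \<omega> \<le> g y \<omega>} \<in> sets M" by measurable
qed

lemma measurable_card_thin:
  assumes "finite A" and p: "\<And>x. x \<in> A \<Longrightarrow> (\<lambda>\<omega>. p \<omega> x) \<in> borel_measurable M"
  shows "(\<lambda>\<omega>. card (thin E (p \<omega>) A)) \<in> measurable M (count_space UNIV)"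
proof -
  have "(\<lambda>\<omega>. {x \<in> A. \<forall>y\<in>{y \<in> A. E x \<le> E y}. p \<omega> x \<le> p \<omega> y}) \<in> measurable M (count_space UNIV)"
    using assms by (intro measurable_Collect_finite pred_ball_le) auto
  moreover have "{x \<in> A. \<forall>y\<in>{y \<in> A. E x \<le> E y}. p \<omega> x \<le> p \<omega> y} = thin E (p \<omega>) A" for \<omega>
    by (fastforce simp: thin_def not_less)
  ultimately have "(\<lambda>\<omega>. thin E (p \<omega>) A) \<in> measurable M (count_space UNIV)"
    by simp
  then show ?thesis
    by (rule measurable_compose) simp
qed

lemma measurable_arg_min_finite:
  fixes p :: "'a \<Rightarrow> 'b \<Rightarrow> real"
  assumes "finite A" and p: "\<And>x. x \<in> A \<Longrightarrow> (\<lambda>\<omega>. p \<omega> x) \<in> borel_measurable M"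
  shows "(\<lambda>\<omega>. arg_min (p \<omega>) (\<lambda>x. x \<in> A)) \<in> measurable M (count_space UNIV)"
proof -
  have "(\<lambda>\<omega>. {x \<in> A. \<forall>y\<in>A. p \<omega> x \<le> p \<omega> y}) \<in> measurable M (count_space UNIV)"
    using assms by (intro measurable_Collect_finite pred_ball_le) auto
  \<comment> \<open>The choice is a function of the random set of minimisers alone, and every
    function on a discrete space is measurable.\<close>
  then have "(\<lambda>\<omega>. SOME x. x \<in> {x \<in> A. \<forall>y\<in>A. p \<omega> x \<le> p \<omega> y}) \<in> measurable M (count_space UNIV)"
    by (rule measurable_compose) simp
  then show ?thesis
    unfolding arg_min_def is_arg_min_linorder mem_Collect_eq Ball_def .
qed

section \<open>Exponential priorities in one copy\<close>

locale exponential_priorities =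
  fixes w :: "nat \<Rightarrow> real"
  assumes rate_pos: "\<And>i. 0 < w i"
begin

abbreviation \<mu> :: "nat \<Rightarrow> real measure" where
  "\<mu> i \<equiv> density lborel (exponential_density (w i))"

text \<open>A property of the factors at all indices, which is why the locale demands positive rates
  beyond the items of the stream.\<close>

sublocale product_sigma_finite \<mu>
  by (simp add: product_sigma_finite_def prob_space_imp_sigma_finite prob_space_exponential_density rate_pos)

lemma prob_space_PiM_exponential: "prob_space (PiM A \<mu>)"
  by (intro prob_space_PiM prob_space_exponential_density rate_pos)

lemma sum_rate_nonneg: "0 \<le> sum w A"
  by (intro sum_nonneg less_imp_le rate_pos)

text \<open>The factor \<open>exp (- V * u)\<close> is the probability that independent competitors
  of total rate \<open>V\<close> all have priority at least \<open>u\<close>. The case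
  \<open>V = 0\<close> is the exponential tail.\<close>

lemma nn_integral_exp_tail:
  assumes "0 \<le> V" "0 \<le> t"
  shows "(\<integral>\<^sup>+u. ennreal (exp (- V * u)) * indicator {t..} u \<partial>\<mu> i)
       = ennreal (w i / (V + w i) * exp (- (V + w i) * t))"
proof -
  let ?r = "V + w i"
  have r: "0 < ?r" using assms rate_pos[of i] by simp
  have "(\<integral>\<^sup>+u. ennreal (exp (- V * u)) * indicator {t..} u \<partial>\<mu> i)
      = (\<integral>\<^sup>+u. ennreal (exponential_density (w i) u) * (ennreal (exp (- V * u)) * indicator {t..} u) \<partial>lborel)"
    by (subst nn_integral_density) auto
  also have "\<dots> = (\<integral>\<^sup>+u. ennreal (w i * exp (- ?r * u)) * indicator {t..} u \<partial>lborel)"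
    using assms rate_pos[of i]
    by (intro nn_integral_cong)
      (auto simp: exponential_density_def indicator_def ennreal_mult[symmetric] exp_add[symmetric] algebra_simps)
  also have "\<dots> = ennreal (0 - (- (w i / ?r) * exp (- ?r * t)))"
  proof (rule nn_integral_FTC_atLeast)
    have "((\<lambda>u. - (a / r) * exp (- r * u)) has_real_derivative a * exp (- r * u)) (at u)"
      if "0 < r" for a r u :: real
      using that by (auto intro!: derivative_eq_intros)
    from this[OF r] show "((\<lambda>u. - (w i / ?r) * exp (- ?r * u)) has_real_derivative w i * exp (- ?r * u)) (at u)" for u .
    have "((\<lambda>u. exp (- ?r * u)) \<longlongrightarrow> 0) at_top"
      using r by (intro filterlim_compose[OF exp_at_bot] filterlim_tendsto_neg_mult_at_bot[OF tendsto_const _ filterlim_ident]) simp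
    then show "((\<lambda>u. - (w i / ?r) * exp (- ?r * u)) \<longlongrightarrow> 0) at_top"
      by (rule tendsto_mult_right_zero)
  qed (use rate_pos[of i] in auto)
  finally show ?thesis by simp
qed

lemma AE_exponential_nonneg: "AE u in \<mu> i. 0 \<le> u"
  by (subst AE_density) (auto simp: exponential_density_def not_less[symmetric])

lemma emeasure_all_ge:
  assumes "finite B" "0 \<le> t"
  shows "emeasure (PiM B \<mu>) {p \<in> space (PiM B \<mu>). \<forall>j\<in>B. t \<le> p j} = ennreal (exp (- sum w B * t))"
proof -
  have "{p \<in> space (PiM B \<mu>). \<forall>j\<in>B. t \<le> p j} = (\<Pi>\<^sub>E j\<in>B. {t..})"
    by (auto simp: space_PiM PiE_def Pi_def)
  also have "emeasure (PiM B \<mu>) \<dots> = (\<Prod>j\<in>B. emeasure (\<mu> j) {t..})"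
    using assms by (intro emeasure_PiM) auto
  also have "\<dots> = (\<Prod>j\<in>B. ennreal (exp (- w j * t)))"
  proof (intro prod.cong refl)
    fix j
    have "emeasure (\<mu> j) {t..} = (\<integral>\<^sup>+u. ennreal (exp (- 0 * u)) * indicator {t..} u \<partial>\<mu> j)"
      by simp
    also have "\<dots> = ennreal (exp (- w j * t))"
      using nn_integral_exp_tail[of 0 t j] assms rate_pos[of j] by simp
    finally show "emeasure (\<mu> j) {t..} = ennreal (exp (- w j * t))" .
  qed
  also have "\<dots> = ennreal (exp (- sum w B * t))"
    using assms by (simp add: prod_ennreal exp_sum[symmetric] sum_negf sum_distrib_right)
  finally show ?thesis .
qed

text \<open>Condition on the priority \<open>u\<close> of item \<open>i\<close>: the others are all
  at least \<open>u\<close> with probability \<open>exp (- sum w B * u)\<close>. Integrating over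
  \<open>u\<close> gives the quotient.\<close>

lemma emeasure_is_minimum:
  assumes "finite A" "i \<in> A"
  shows "emeasure (PiM A \<mu>) {p \<in> space (PiM A \<mu>). \<forall>j\<in>A. p i \<le> p j} = ennreal (w i / sum w A)"
proof -
  define B where "B = A - {i}"
  have A: "A = insert i B" "i \<notin> B" "finite B" using assms by (auto simp: B_def)
  let ?X = "{p \<in> space (PiM (insert i B) \<mu>). \<forall>j\<in>insert i B. p i \<le> p j}"
  have X: "?X \<in> sets (PiM (insert i B) \<mu>)"
    unfolding pred_def[symmetric] using A by (intro pred_ball_le) auto
  have "emeasure (PiM (insert i B) \<mu>) ?X
      = (\<integral>\<^sup>+u. (\<integral>\<^sup>+p. indicator ?X (p(i := u)) \<partial>PiM B \<mu>) \<partial>\<mu> i)"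
    using A X by (subst product_nn_integral_insert_rev[symmetric]) auto
  also have "\<dots> = (\<integral>\<^sup>+u. ennreal (exp (- sum w B * u)) * indicator {0..} u \<partial>\<mu> i)"
  \<comment> \<open>Negative \<open>u\<close> form a null set, and the formula for the other
    priorities needs \<open>u\<close> nonnegative.\<close>
  proof (rule nn_integral_cong_AE, use AE_exponential_nonneg[of i] in eventually_elim)
    fix u :: real assume u: "0 \<le> u"
    have "(\<integral>\<^sup>+p. indicator ?X (p(i := u)) \<partial>PiM B \<mu>)
        = (\<integral>\<^sup>+p. indicator {p \<in> space (PiM B \<mu>). \<forall>j\<in>B. u \<le> p j} p \<partial>PiM B \<mu>)"
      using A(2) by (intro nn_integral_cong) (auto simp: indicator_def space_PiM PiE_def extensional_def Pi_def)
    also have "\<dots> = emeasure (PiM B \<mu>) {p \<in> space (PiM B \<mu>). \<forall>j\<in>B. u \<le> p j}"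
      using A(3) by (intro nn_integral_indicator, unfold pred_def[symmetric]) (intro pred_ball_le, auto)
    finally show "(\<integral>\<^sup>+p. indicator ?X (p(i := u)) \<partial>PiM B \<mu>) = ennreal (exp (- sum w B * u)) * indicator {0..} u"
      using u by (simp add: emeasure_all_ge[OF A(3)])
  qed
  also have "\<dots> = ennreal (w i / sum w A)"
    using nn_integral_exp_tail[of "sum w B" 0 i] sum_rate_nonneg[of B] A by (simp add: add.commute)
  finally show ?thesis by (simp add: A(1))
qed

text \<open>Items are added in order of decreasing expiration time. The threshold \<open>t\<close>
  is needed for the induction: when the new priority \<open>u\<close> is a minimum, the remaining
  items are conditioned to have priorities at least \<open>u\<close>.\<close>

lemma nn_integral_card_thin_tail:
  assumes "finite A" and w1: "\<And>i. i \<in> A \<Longrightarrow> 1 \<le> w i" and "0 \<le> t"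
  shows "(\<integral>\<^sup>+p. 2 ^ card (thin E p A) * indicator {p. \<forall>y\<in>A. t \<le> p y} p \<partial>PiM A \<mu>)
       \<le> ennreal ((1 + sum w A) * exp (- sum w A * t))"
  using assms
proof (induction A arbitrary: t rule: finite_ranking_induct[where f = "\<lambda>i. - E i"])
  case empty
  then show ?case by (simp add: thin_def prob_space.emeasure_space_1[OF prob_space_PiM_exponential])
next
  case (insert x B)
  show ?case
  \<comment> \<open>The ranking induction does not rule out inserting an element already
    present.\<close>
  proof (cases "x \<in> B")
    case True
    then show ?thesis using insert by (simp add: insert_absorb)
  next
    case False
    define F :: "real \<Rightarrow> (nat \<Rightarrow> real) \<Rightarrow> ennreal"
      where "F s p = 2 ^ card (thin E p B) * indicator {p. \<forall>y\<in>B. s \<le> p y} p" for s p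
    define V where "V = sum w B"
    have V: "0 \<le> V" "sum w (insert x B) = V + w x"
      using sum_rate_nonneg[of B] False insert.hyps by (auto simp: V_def)
    have [measurable]: "(\<lambda>p. card (thin E p C)) \<in> measurable (PiM C \<mu>) (count_space UNIV)"
      if "finite C" for C
      using that by (intro measurable_card_thin) auto
    have ind: "(\<lambda>p. indicator {p. \<forall>y\<in>C. s \<le> p y} p :: ennreal) \<in> borel_measurable (PiM C \<mu>)"
      if "finite C" for C s
    proof -
      have "(\<lambda>p. if \<forall>y\<in>C. s \<le> p y then 1 else 0 :: ennreal) \<in> borel_measurable (PiM C \<mu>)"
        using that by (intro measurable_If borel_measurable_const, unfold pred_def[symmetric]) (intro pred_ball_le, auto)
      then show ?thesis by (simp add: indicator_def)
    qed
    have F [measurable]: "F s \<in> borel_measurable (PiM B \<mu>)" for s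
      unfolding F_def using ind[OF insert.hyps(1)] insert.hyps(1) by measurable
    have IH: "(\<integral>\<^sup>+p. F s p \<partial>PiM B \<mu>) \<le> ennreal ((1 + V) * exp (- V * s))" if "0 \<le> s" for s
      using insert.IH[of s] insert.prems that by (simp add: F_def V_def)
    \<comment> \<open>If \<open>u\<close> is a new minimum, the count grows by at most one and the
      power at most doubles; the second copy is \<open>F u p\<close>. Otherwise \<open>F u p\<close>
      vanishes and the count does not grow.\<close>
    have step: "2 ^ card (thin E (p(x := u)) (insert x B)) * indicator {p. \<forall>y\<in>insert x B. t \<le> p y} (p(x := u))
        \<le> (F t p + F u p) * indicator {t..} u" for p u
    proof (cases "t \<le> u \<and> (\<forall>y\<in>B. t \<le> p y)")
      case True
      have thinB: "thin E (p(x := u)) B = thin E p B"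
        using False by (intro thin_cong) auto
      have "card (thin E (p(x := u)) (insert x B)) \<le> card (thin E p B) + (if \<forall>y\<in>B. u \<le> p y then 1 else 0)"
        using card_thin_insert_le[of B x E "p(x := u)"] False insert.hyps thinB
        by (auto split: if_splits)
      then have "(2::ennreal) ^ card (thin E (p(x := u)) (insert x B))
          \<le> 2 ^ (card (thin E p B) + (if \<forall>y\<in>B. u \<le> p y then 1 else 0))"
        by (rule power_increasing) simp
      also have "\<dots> = F t p + F u p"
        using True by (auto simp: F_def indicator_def mult_2)
      finally show ?thesis using True False by (auto simp: indicator_def)
    qed (use \<open>x \<notin> B\<close> in \<open>auto simp: indicator_def\<close>)
    have "(\<integral>\<^sup>+p. 2 ^ card (thin E p (insert x B)) * indicator {p. \<forall>y\<in>insert x B. t \<le> p y} p \<partial>PiM (insert x B) \<mu>)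
        = (\<integral>\<^sup>+u. (\<integral>\<^sup>+p. 2 ^ card (thin E (p(x := u)) (insert x B)) *
             indicator {p. \<forall>y\<in>insert x B. t \<le> p y} (p(x := u)) \<partial>PiM B \<mu>) \<partial>\<mu> x)"
      using False insert.hyps ind[of "insert x B" t] by (intro product_nn_integral_insert_rev) measurable
    also have "\<dots> \<le> (\<integral>\<^sup>+u. (\<integral>\<^sup>+p. (F t p + F u p) * indicator {t..} u \<partial>PiM B \<mu>) \<partial>\<mu> x)"
      by (intro nn_integral_mono step)
    also have "\<dots> = (\<integral>\<^sup>+u. ((\<integral>\<^sup>+p. F t p \<partial>PiM B \<mu>) + (\<integral>\<^sup>+p. F u p \<partial>PiM B \<mu>)) * indicator {t..} u \<partial>\<mu> x)"
      by (simp add: nn_integral_multc nn_integral_add)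
    \<comment> \<open>The factor \<open>exp (- 0 * u)\<close> puts the first summand into the form
      of \<open>nn_integral_exp_tail\<close> with \<open>V = 0\<close>.\<close>
    also have "\<dots> \<le> (\<integral>\<^sup>+u. ennreal ((1 + V) * exp (- V * t)) * (ennreal (exp (- 0 * u)) * indicator {t..} u) +
        ennreal (1 + V) * (ennreal (exp (- V * u)) * indicator {t..} u) \<partial>\<mu> x)"
    proof (rule nn_integral_mono)
      fix u
      show "((\<integral>\<^sup>+p. F t p \<partial>PiM B \<mu>) + (\<integral>\<^sup>+p. F u p \<partial>PiM B \<mu>)) * indicator {t..} u
          \<le> ennreal ((1 + V) * exp (- V * t)) * (ennreal (exp (- 0 * u)) * indicator {t..} u) +
            ennreal (1 + V) * (ennreal (exp (- V * u)) * indicator {t..} u)"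
        using add_mono[OF IH[of t] IH[of u]] insert.prems(2) V(1)
        by (cases "t \<le> u") (auto simp: ennreal_mult)
    qed
    also have "\<dots> = ennreal ((1 + V) * exp (- V * t)) * ennreal (w x / (0 + w x) * exp (- (0 + w x) * t)) +
        ennreal (1 + V) * ennreal (w x / (V + w x) * exp (- (V + w x) * t))"
      using insert.prems(2) V(1)
      by (subst nn_integral_add, simp, simp, subst (1 2) nn_integral_cmult, simp, simp)
        (simp only: nn_integral_exp_tail order.refl)
    also have "\<dots> = ennreal ((1 + V) * (1 + w x / (V + w x)) * exp (- (V + w x) * t))"
      using rate_pos[of x] V(1)
      by (simp add: ennreal_mult[symmetric] ennreal_plus[symmetric] exp_add[symmetric] algebra_simps del: ennreal_plus)
    also have "\<dots> \<le> ennreal ((1 + (V + w x)) * exp (- (V + w x) * t))"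
    proof (intro ennreal_leI mult_right_mono)
      \<comment> \<open>Weights of at least 1 enter here, as
        \<open>1 + V \<le> V + w x\<close>.\<close>
      have "(1 + V) * w x \<le> w x * (V + w x)"
        using insert.prems(1)[of x] V(1) mult_left_mono[of "1 + V" "V + w x" "w x"] by (simp add: mult.commute)
      then have "(1 + V) * (w x / (V + w x)) \<le> w x"
        using rate_pos[of x] V(1) by (simp add: field_simps)
      then show "(1 + V) * (1 + w x / (V + w x)) \<le> 1 + (V + w x)"
        by (simp add: distrib_left)
    qed simp
    finally show ?thesis by (simp add: V(2))
  qed
qed

lemma nn_integral_card_thin:
  assumes "finite A" "\<And>i. i \<in> A \<Longrightarrow> 1 \<le> w i"
  shows "(\<integral>\<^sup>+p. 2 ^ card (thin E p A) \<partial>PiM A \<mu>) \<le> ennreal (1 + sum w A)"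
proof -
  have "AE p in PiM A \<mu>. \<forall>y\<in>A. 0 \<le> p y"
    using assms(1)
    by (intro eventually_ball_finite ballI AE_PiM_component AE_exponential_nonneg
        prob_space_exponential_density rate_pos)
  then have "(\<integral>\<^sup>+p. 2 ^ card (thin E p A) \<partial>PiM A \<mu>)
      = (\<integral>\<^sup>+p. 2 ^ card (thin E p A) * indicator {p. \<forall>y\<in>A. 0 \<le> p y} p \<partial>PiM A \<mu>)"
    by (intro nn_integral_cong_AE) (auto elim!: eventually_mono)
  also have "\<dots> \<le> ennreal (1 + sum w A)"
    using nn_integral_card_thin_tail[OF assms, of 0] by simp
  finally show ?thesis .
qed

section \<open>Independent copies and the law of a sample\<close>

lemma priorities_eq: "priorities k n w = PiM ({..<k} \<times> {..<n}) (\<lambda>x. \<mu> (snd x))"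
  by (simp add: priorities_def case_prod_unfold)

lemma prob_space_priorities': "prob_space (priorities k n w)"
  by (rule prob_space_priorities) (rule rate_pos)

lemma measurable_copy:
  "c < k \<Longrightarrow> i < n \<Longrightarrow> (\<lambda>\<omega>. copy c \<omega> i) \<in> borel_measurable (priorities k n w)"
  using measurable_component_singleton[of "(c, i)" "{..<k} \<times> {..<n}" "\<lambda>x. \<mu> (snd x)"]
  by (simp add: copy_def priorities_eq)

lemma measurable_restrict_copy:
  "c < k \<Longrightarrow> A \<subseteq> {..<n} \<Longrightarrow> (\<lambda>\<omega>. \<lambda>i\<in>A. copy c \<omega> i) \<in> measurable (priorities k n w) (PiM A \<mu>)"
  by (intro measurable_restrict) (auto intro: measurable_copy)

lemma distr_copy:
  assumes "c < k" "A \<subseteq> {..<n}"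
  shows "distr (priorities k n w) (PiM A \<mu>) (\<lambda>\<omega>. \<lambda>i\<in>A. copy c \<omega> i) = PiM A \<mu>"
  using distr_PiM_reindex[of "{..<k} \<times> {..<n}" "\<lambda>x. \<mu> (snd x)" "Pair c" A] assms
  by (auto simp: copy_def priorities_eq inj_on_def prob_space_exponential_density rate_pos)

text \<open>Independence holds because the joint law is the product of the marginals. That criterion
  requires a nonempty index set, hence both positivity assumptions.\<close>

lemma indep_vars_coordinates:
  assumes "0 < k" "0 < n"
  shows "prob_space.indep_vars (priorities k n w) (\<lambda>x. \<mu> (snd x)) (\<lambda>x \<omega>. \<omega> x) ({..<k} \<times> {..<n})"
proof -
  let ?I = "{..<k} \<times> {..<n}" and ?M = "\<lambda>x :: nat \<times> nat. \<mu> (snd x)"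
  interpret prob_space "priorities k n w" by (rule prob_space_priorities')
  have "distr (PiM ?I ?M) (PiM ?I ?M) (\<lambda>\<omega>. restrict \<omega> ?I) = distr (PiM ?I ?M) (PiM ?I ?M) (\<lambda>\<omega>. \<omega>)"
    by (intro distr_cong) (auto simp: space_PiM PiE_def extensional_restrict)
  moreover have "PiM ?I (\<lambda>x. distr (PiM ?I ?M) (?M x) (\<lambda>\<omega>. \<omega> x)) = PiM ?I ?M"
  proof (intro PiM_cong refl)
    fix x assume "x \<in> ?I"
    then show "distr (PiM ?I ?M) (?M x) (\<lambda>\<omega>. \<omega> x) = ?M x"
      by (intro distr_PiM_component prob_space_exponential_density rate_pos)
  qed
  ultimately show ?thesis
    using assms by (subst indep_vars_iff_distr_eq_PiM') (auto simp: priorities_eq)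
qed

text \<open>Different copies read disjoint blocks \<open>{c} \<times> A\<close> of
  coordinates.\<close>

lemma indep_vars_copies:
  assumes "A \<subseteq> {..<n}" "g \<in> measurable (PiM A \<mu>) N" "0 < n"
  shows "prob_space.indep_vars (priorities k n w) (\<lambda>_. N) (\<lambda>c \<omega>. g (\<lambda>i\<in>A. copy c \<omega> i)) {..<k}"
proof -
  interpret prob_space "priorities k n w" by (rule prob_space_priorities')
  have rv: "random_variable N (\<lambda>\<omega>. g (\<lambda>i\<in>A. copy c \<omega> i))" if "c < k" for c
    using measurable_compose[OF measurable_restrict_copy[OF that assms(1)] assms(2)] by simp
  show ?thesis
  proof (cases "0 < k")
    case True
    have "indep_vars (\<lambda>c. PiM ({c} \<times> A) (\<lambda>x. \<mu> (snd x))) (\<lambda>c \<omega>. restrict (\<lambda>x. \<omega> x) ({c} \<times> A)) {..<k}"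
      using assms(1,3) True
      by (intro indep_vars_restrict[OF indep_vars_coordinates]) (auto simp: disjoint_family_on_def)
    moreover have "(\<lambda>\<rho>. g (\<lambda>i\<in>A. copy c \<rho> i)) \<in> measurable (PiM ({c} \<times> A) (\<lambda>x. \<mu> (snd x))) N" for c
    proof (rule measurable_compose[OF _ assms(2)], rule measurable_restrict)
      fix i assume "i \<in> A"
      then show "(\<lambda>\<rho>. copy c \<rho> i) \<in> measurable (PiM ({c} \<times> A) (\<lambda>x. \<mu> (snd x))) (\<mu> i)"
        using measurable_component_singleton[of "(c, i)" "{c} \<times> A" "\<lambda>x. \<mu> (snd x)"] by (simp add: copy_def)
    qed
    ultimately have "indep_vars (\<lambda>_. N) (\<lambda>c \<omega>. g (\<lambda>i\<in>A. copy c (restrict (\<lambda>x. \<omega> x) ({c} \<times> A)) i)) {..<k}"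
      by (rule indep_vars_compose2[where Y = "\<lambda>c \<rho>. g (\<lambda>i\<in>A. copy c \<rho> i)"])
    moreover have "(\<lambda>i\<in>A. copy c (restrict (\<lambda>x. \<omega> x) ({c} \<times> A)) i) = (\<lambda>i\<in>A. copy c \<omega> i)" for c \<omega>
      by (auto simp: copy_def restrict_def fun_eq_iff)
    ultimately show ?thesis by simp
  next
    case False
    \<comment> \<open>The empty family is independent straight from the definition.\<close>
    then have "k = 0" using assms(3) by simp
    then show ?thesis
      unfolding indep_vars_def2 indep_sets_def by simp
  qed
qed

lemma arg_min_restrict: "arg_min (\<lambda>i\<in>A. p i) (\<lambda>x. x \<in> A) = arg_min p (\<lambda>x. x \<in> A)"
  unfolding arg_min_def by (subst is_arg_min_cong[where q = p]) auto

lemma thin_restrict: "thin E (\<lambda>i\<in>A. p i) A = thin E p A"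
  by (rule thin_cong) auto

lemma measurable_arg_min_PiM:
  "finite A \<Longrightarrow> (\<lambda>p. arg_min p (\<lambda>x. x \<in> A)) \<in> measurable (PiM A \<mu>) (count_space UNIV)"
  by (rule measurable_arg_min_finite) auto

lemma indep_vars_arg_min:
  assumes "A \<subseteq> {..<n}" "0 < n"
  shows "prob_space.indep_vars (priorities k n w) (\<lambda>_. count_space UNIV)
    (\<lambda>c \<omega>. arg_min (copy c \<omega>) (\<lambda>x. x \<in> A)) {..<k}"
  using indep_vars_copies[OF assms(1) measurable_arg_min_PiM assms(2)] finite_subset[OF assms(1)]
  by (simp add: arg_min_restrict)

lemma measure_arg_min:
  assumes "A \<subseteq> {..<n}" "c < k" "i \<in> A"
  shows "measure (priorities k n w)
    {\<omega> \<in> space (priorities k n w). arg_min (copy c \<omega>) (\<lambda>x. x \<in> A) = i} = w i / sum w A"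
proof -
  let ?P = "priorities k n w"
  let ?q = "\<lambda>\<omega>. arg_min (copy c \<omega>) (\<lambda>x. x \<in> A)"
  define Q where "Q j = {\<omega> \<in> space ?P. ?q \<omega> = j}" for j
  interpret prob_space ?P by (rule prob_space_priorities')
  have fin: "finite A" using assms(1) by (rule finite_subset) simp
  have q: "?q \<in> measurable ?P (count_space UNIV)"
    using assms by (intro measurable_arg_min_finite fin measurable_copy) auto
  have Q: "Q j \<in> events" for j
    using measurable_sets[OF q, of "{j}"] by (simp add: Q_def vimage_def Int_def conj_commute)
  have arg_min: "?q \<omega> \<in> A \<and> (\<forall>y\<in>A. copy c \<omega> (?q \<omega>) \<le> copy c \<omega> y)" for \<omega>
  proof -
    have "is_arg_min (copy c \<omega>) (\<lambda>x. x \<in> A) (?q \<omega>)"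
      unfolding arg_min_def by (rule someI_ex, rule ex_is_arg_min_if_finite) (use fin assms(3) in auto)
    then show ?thesis by (auto simp: is_arg_min_linorder)
  qed
  have le: "prob (Q j) \<le> w j / sum w A" if j: "j \<in> A" for j
  proof -
    let ?X = "{p \<in> space (PiM A \<mu>). \<forall>y\<in>A. p j \<le> p y}"
    have X: "?X \<in> sets (PiM A \<mu>)"
      unfolding pred_def[symmetric] using fin j by (intro pred_ball_le) auto
    have r: "(\<lambda>\<omega>. \<lambda>i\<in>A. copy c \<omega> i) \<in> measurable ?P (PiM A \<mu>)"
      using assms by (intro measurable_restrict_copy)
    \<comment> \<open>Only an inclusion of events is available: on a tie, \<open>j\<close> may be a
      minimiser without being chosen.\<close>
    have "emeasure ?P (Q j) \<le> emeasure ?P ((\<lambda>\<omega>. \<lambda>i\<in>A. copy c \<omega> i) -` ?X \<inter> space ?P)"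
    proof (rule emeasure_mono)
      show "Q j \<subseteq> (\<lambda>\<omega>. \<lambda>i\<in>A. copy c \<omega> i) -` ?X \<inter> space ?P"
        using arg_min measurable_space[OF r] j by (auto simp: Q_def)
      show "(\<lambda>\<omega>. \<lambda>i\<in>A. copy c \<omega> i) -` ?X \<inter> space ?P \<in> events"
        using measurable_sets[OF r X] .
    qed
    also have "\<dots> = emeasure (PiM A \<mu>) ?X"
      using distr_copy[OF assms(2,1)] emeasure_distr[OF r X] by simp
    also have "\<dots> = ennreal (w j / sum w A)"
      by (rule emeasure_is_minimum[OF fin j])
    finally show ?thesis
      using rate_pos[of j] sum_rate_nonneg[of A] by (simp add: emeasure_eq_measure)
  qed
  have "(\<Sum>j\<in>A. prob (Q j)) = prob (\<Union>j\<in>A. Q j)"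
    using Q fin by (intro finite_measure_finite_Union[symmetric]) (auto simp: disjoint_family_on_def Q_def)
  also have "(\<Union>j\<in>A. Q j) = space ?P"
    using arg_min by (auto simp: Q_def)
  also have "prob (space ?P) = (\<Sum>j\<in>A. w j / sum w A)"
  proof -
    have "0 < sum w A" using fin assms(3) rate_pos by (intro sum_pos) auto
    then show ?thesis by (simp add: prob_space sum_divide_distrib[symmetric])
  qed
  \<comment> \<open>Termwise inequalities between two sums with equal totals must all be
    equalities.\<close>
  finally have "prob (Q i) = w i / sum w A"
    using le assms(3) fin by (rule sum_mono_inv)
  then show ?thesis by (simp add: Q_def)
qed

text \<open>The power of two of the total count is a product over the copies, so by independence its
  expectation is the product of the single-copy expectations.\<close>

lemma nn_integral_copies_card_thin:
  assumes "A \<subseteq> {..<n}" "\<And>i. i \<in> A \<Longrightarrow> 1 \<le> w i" "0 < n"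
  shows "(\<integral>\<^sup>+\<omega>. 2 ^ (\<Sum>c<k. card (thin E (copy c \<omega>) A)) \<partial>priorities k n w) \<le> ennreal ((1 + sum w A) ^ k)"
proof -
  let ?P = "priorities k n w"
  interpret prob_space ?P by (rule prob_space_priorities')
  define g :: "(nat \<Rightarrow> real) \<Rightarrow> ennreal" where "g p = 2 ^ card (thin E p A)" for p
  have fin: "finite A" using assms(1) by (rule finite_subset) simp
  have g: "g \<in> borel_measurable (PiM A \<mu>)"
  proof -
    have "(\<lambda>p. card (thin E p A)) \<in> measurable (PiM A \<mu>) (count_space UNIV)"
      using fin by (intro measurable_card_thin) auto
    then show ?thesis unfolding g_def by (rule measurable_compose) simp
  qed
  have gr: "g (\<lambda>i\<in>A. p i) = 2 ^ card (thin E p A)" for p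
    by (simp add: g_def thin_restrict)
  have "(\<integral>\<^sup>+\<omega>. 2 ^ (\<Sum>c<k. card (thin E (copy c \<omega>) A)) \<partial>?P)
      = (\<integral>\<^sup>+\<omega>. (\<Prod>c<k. g (\<lambda>i\<in>A. copy c \<omega> i)) \<partial>?P)"
    by (simp add: power_sum gr)
  also have "\<dots> = (\<Prod>c<k. \<integral>\<^sup>+\<omega>. g (\<lambda>i\<in>A. copy c \<omega> i) \<partial>?P)"
    using indep_vars_copies[OF assms(1) g assms(3)] by (intro indep_vars_nn_integral) auto
  also have "\<dots> \<le> (\<Prod>c<k. ennreal (1 + sum w A))"
  proof (rule prod_mono_ennreal)
    fix c assume "c \<in> {..<k}"
    then have c: "c < k" by simp
    have "(\<integral>\<^sup>+\<omega>. g (\<lambda>i\<in>A. copy c \<omega> i) \<partial>?P)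
        = (\<integral>\<^sup>+p. g p \<partial>distr ?P (PiM A \<mu>) (\<lambda>\<omega>. \<lambda>i\<in>A. copy c \<omega> i))"
      using measurable_restrict_copy[OF c assms(1)] g by (simp add: nn_integral_distr)
    also have "\<dots> \<le> ennreal (1 + sum w A)"
      unfolding distr_copy[OF c assms(1)] g_def by (rule nn_integral_card_thin[OF fin assms(2)])
    finally show "(\<integral>\<^sup>+\<omega>. g (\<lambda>i\<in>A. copy c \<omega> i) \<partial>?P) \<le> ennreal (1 + sum w A)" .
  qed
  finally show ?thesis
    using sum_rate_nonneg[of A] by (simp add: ennreal_power del: ennreal_plus)
qed

section \<open>Tail bound and union bound for the total size\<close>

lemma measurable_sum_card_thin:
  assumes "A \<subseteq> {..<n}"
  shows "(\<lambda>\<omega>. \<Sum>c<k. card (thin E (copy c \<omega>) A)) \<in> measurable (priorities k n w) (count_space UNIV)"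
  using finite_subset[OF assms] assms
  by (intro measurable_sum_nat measurable_card_thin measurable_copy) auto

text \<open>With \<open>L = ln (W / \<delta>)\<close>, exceeding the bound means
  \<open>2 ^ N > exp (3 * k * L)\<close>, while the expectation of \<open>2 ^ N\<close> is at most
  \<open>exp (2 * k * L)\<close>. Markov's inequality leaves \<open>exp (- k * L)\<close>, which is
  at most \<open>\<delta> / W\<close> since \<open>k\<close> is at least 1. This is the origin of
  the constant \<open>3 / ln 2\<close>.\<close>

lemma prob_size_exceeds:
  assumes "A \<subseteq> {..<n}" "\<And>i. i < n \<Longrightarrow> 1 \<le> w i" "2 \<le> sum w {..<n}" "0 < \<delta>" "\<delta> < 1" "0 < k"
  shows "measure (priorities k n w) {\<omega> \<in> space (priorities k n w).
      3 / ln 2 * real k * ln (sum w {..<n} / \<delta>) < real (\<Sum>c<k. card (thin E (copy c \<omega>) A))}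
    \<le> \<delta> / sum w {..<n}"
proof -
  let ?P = "priorities k n w" and ?N = "\<lambda>\<omega>. \<Sum>c<k. card (thin E (copy c \<omega>) A)"
  define W where "W = sum w {..<n}"
  define L where "L = ln (W / \<delta>)"
  interpret prob_space ?P by (rule prob_space_priorities')
  have n: "0 < n" using assms(3) by (cases n) auto
  have W: "2 \<le> W" using assms(3) by (simp add: W_def)
  have expL: "exp L = W / \<delta>" using W assms(4) by (simp add: L_def)
  have WL: "W \<le> exp L" using W assms(4,5) mult_right_mono[of \<delta> 1 W] by (simp add: expL field_simps)
  then have L: "0 \<le> L" using W one_le_exp_iff[of L] by linarith
  have bound: "(1 + sum w A) ^ k \<le> exp (2 * real k * L)"
  proof -
    have "sum w A \<le> W"
      unfolding W_def using assms(1) rate_pos by (intro sum_mono2) (auto intro: less_imp_le)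
    \<comment> \<open>Here \<open>W \<ge> 2\<close> gives
      \<open>1 + W \<le> 2 * W \<le> W * W\<close>.\<close>
    then have "1 + sum w A \<le> W * W"
      using W mult_right_mono[of 2 W W] by linarith
    also have "\<dots> \<le> exp L * exp L"
      using W WL by (intro mult_mono) auto
    finally have "(1 + sum w A) ^ k \<le> (exp L * exp L) ^ k"
      using sum_rate_nonneg[of A] by (intro power_mono) auto
    also have "\<dots> = exp (2 * real k * L)"
      by (simp add: exp_add[symmetric] exp_of_nat_mult[symmetric] algebra_simps)
    finally show ?thesis .
  qed
  have "emeasure ?P {\<omega> \<in> space ?P. 3 / ln 2 * real k * L < real (?N \<omega>)}
      \<le> emeasure ?P {\<omega> \<in> space ?P. 1 \<le> ennreal (exp (- 3 * real k * L)) * 2 ^ ?N \<omega>}"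
  proof (rule emeasure_mono)
    have "(\<lambda>\<omega>. ennreal (exp (- 3 * real k * L)) * 2 ^ ?N \<omega>) \<in> borel_measurable ?P"
      by (rule measurable_compose[OF measurable_sum_card_thin[OF assms(1)]]) simp
    then show "{\<omega> \<in> space ?P. 1 \<le> ennreal (exp (- 3 * real k * L)) * 2 ^ ?N \<omega>} \<in> events"
      by measurable
    have "1 \<le> ennreal (exp (- 3 * real k * L)) * 2 ^ N" if "3 / ln 2 * real k * L < real N" for N
    proof -
      have "3 * real k * L \<le> real N * ln 2"
        using that by (simp add: field_simps)
      then have "exp (3 * real k * L) \<le> 2 ^ N"
        by (metis exp_le_cancel_iff exp_ln exp_of_nat_mult zero_less_numeral)
      then have "1 \<le> exp (- 3 * real k * L) * 2 ^ N"
        by (simp add: exp_minus field_simps)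
      then have "ennreal 1 \<le> ennreal (exp (- 3 * real k * L) * 2 ^ N)"
        by (rule ennreal_leI)
      then show ?thesis by (simp add: ennreal_mult ennreal_power[symmetric])
    qed
    then show "{\<omega> \<in> space ?P. 3 / ln 2 * real k * L < real (?N \<omega>)}
        \<subseteq> {\<omega> \<in> space ?P. 1 \<le> ennreal (exp (- 3 * real k * L)) * 2 ^ ?N \<omega>}"
      by blast
  qed
  also have "\<dots> \<le> ennreal (exp (- 3 * real k * L)) * (\<integral>\<^sup>+\<omega>. 2 ^ ?N \<omega> * indicator (space ?P) \<omega> \<partial>?P)"
  proof (rule nn_integral_Markov_inequality)
    have "(\<lambda>\<omega>. 2 ^ ?N \<omega> :: ennreal) \<in> borel_measurable ?P"
      by (rule measurable_compose[OF measurable_sum_card_thin[OF assms(1)]]) simp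
    then show "(\<lambda>\<omega>. 2 ^ ?N \<omega> * indicator (space ?P) \<omega> :: ennreal) \<in> borel_measurable ?P"
      by measurable
  qed simp
  also have "(\<integral>\<^sup>+\<omega>. 2 ^ ?N \<omega> * indicator (space ?P) \<omega> \<partial>?P) = (\<integral>\<^sup>+\<omega>. 2 ^ ?N \<omega> \<partial>?P)"
    by (intro nn_integral_cong) simp
  also have "(\<integral>\<^sup>+\<omega>. 2 ^ ?N \<omega> \<partial>?P) \<le> ennreal (exp (2 * real k * L))"
    using nn_integral_copies_card_thin[of A n k E] assms(1,2) n ennreal_leI[OF bound]
    by (meson lessThan_iff order.trans subsetD)
  also have "ennreal (exp (- 3 * real k * L)) * ennreal (exp (2 * real k * L)) = ennreal (exp (- real k * L))"
    by (simp add: ennreal_mult[symmetric] exp_add[symmetric])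
  also have "\<dots> \<le> ennreal (\<delta> / W)"
  proof (rule ennreal_leI)
    have "exp (- real k * L) \<le> exp (- L)"
      using assms(6) L mult_right_mono[of 1 "real k" L] by simp
    then show "exp (- real k * L) \<le> \<delta> / W" by (simp add: exp_minus expL)
  qed
  finally show ?thesis
    using W assms(4) by (simp add: emeasure_eq_measure W_def L_def mult_left_mono)
qed

lemma size_bound:
  assumes "expiration_stream n S E" "\<And>i. i < n \<Longrightarrow> 1 \<le> w i" "2 \<le> sum w {..<n}" "0 < \<delta>" "\<delta> < 1"
  shows "1 - \<delta> \<le> measure (priorities k n w) {\<omega> \<in> space (priorities k n w). \<forall>m t0. moment n S m t0 \<longrightarrow>
      real (\<Sum>c<k. card (stored S E (copy c \<omega>) m t0)) \<le> 3 / ln 2 * real k * ln (sum w {..<n} / \<delta>)}"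
    (is "_ \<le> measure ?P ?G")
proof (cases "k = 0")
  \<comment> \<open>Without copies nothing is stored and the bound is 0; the single-moment estimate
    is only stated for positive \<open>k\<close>.\<close>
  case True
  interpret prob_space ?P by (rule prob_space_priorities')
  show ?thesis using prob_space True assms(4) by simp
next
  case False
  interpret prob_space ?P by (rule prob_space_priorities')
  define b where "b = 3 / ln 2 * real k * ln (sum w {..<n} / \<delta>)"
  define N where "N A \<omega> = (\<Sum>c<k. card (thin E (copy c \<omega>) A))" for A \<omega>
  define Bad where "Bad l = {\<omega> \<in> space ?P. b < real (N (unexpired E (S l) {..<Suc l}) \<omega>)}" for l
  \<comment> \<open>The event quantifies over uncountably many times, but the stored items depend on
    the moment only through its set of unexpired items. There are finitely many such sets, so the
    event is measurable.\<close>
  define \<A> where "\<A> = {unexpired E t0 {..<m} | m t0. moment n S m t0}"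
  have sub: "\<A> \<subseteq> Pow {..<n}" by (auto simp: \<A>_def unexpired_def moment_def)
  have N: "N A \<in> measurable ?P (count_space UNIV)" if "A \<subseteq> {..<n}" for A
    unfolding N_def using that by (rule measurable_sum_card_thin)
  have G: "?G = {\<omega> \<in> space ?P. \<forall>A\<in>\<A>. real (N A \<omega>) \<le> b}"
    using assms(1) by (auto simp: \<A>_def b_def N_def stored_eq_thin)
  have "?G \<in> events"
    unfolding G
  proof (rule sets.sets_Collect_finite_All)
    show "finite \<A>" using sub by (rule finite_subset) simp
    fix A assume "A \<in> \<A>"
    then have "N A \<in> measurable ?P (count_space UNIV)" using sub by (intro N) auto
    then have "(\<lambda>\<omega>. real (N A \<omega>)) \<in> borel_measurable ?P" by (rule measurable_compose) simp
    then show "{\<omega> \<in> space ?P. real (N A \<omega>) \<le> b} \<in> events" by measurable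
  qed
  have Bad: "Bad l \<in> events" "prob (Bad l) \<le> \<delta> / sum w {..<n}" if "l < n" for l
  proof -
    have A: "unexpired E (S l) {..<Suc l} \<subseteq> {..<n}" using that by (auto simp: unexpired_def)
    have "(\<lambda>\<omega>. real (N (unexpired E (S l) {..<Suc l}) \<omega>)) \<in> borel_measurable ?P"
      using N[OF A] by (rule measurable_compose) simp
    then show "Bad l \<in> events" unfolding Bad_def by measurable
    show "prob (Bad l) \<le> \<delta> / sum w {..<n}"
      unfolding Bad_def b_def N_def using prob_size_exceeds[OF A assms(2-5)] False by simp
  qed
  have "prob (\<Union>l<n. Bad l) \<le> (\<Sum>l<n. prob (Bad l))"
    using Bad by (intro finite_measure_subadditive_finite) auto
  also have "\<dots> \<le> real n * (\<delta> / sum w {..<n})"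
    using sum_bounded_above[of "{..<n}" "\<lambda>l. prob (Bad l)" "\<delta> / sum w {..<n}"] Bad by simp
  also have "\<dots> \<le> \<delta>"
  proof -
    \<comment> \<open>Weights of at least 1 make the number of insertions at most \<open>W\<close>,
      so the union bound costs no more than a factor \<open>W\<close>.\<close>
    have "real n \<le> sum w {..<n}"
      using sum_bounded_below[of "{..<n}" 1 w] assms(2) by simp
    then show ?thesis using assms(3,4) by (simp add: field_simps)
  qed
  finally have "1 - \<delta> \<le> prob (space ?P - (\<Union>l<n. Bad l))"
    using Bad by (subst prob_compl) auto
  also have "\<dots> \<le> prob ?G"
  proof (rule finite_measure_mono[OF subsetI \<open>?G \<in> events\<close>], clarify)
    fix \<omega> assume \<omega>: "\<omega> \<in> space ?P" "\<omega> \<notin> (\<Union>l<n. Bad l)"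
    show "real (\<Sum>c<k. card (stored S E (copy c \<omega>) m t0)) \<le> 3 / ln 2 * real k * ln (sum w {..<n} / \<delta>)"
      if m: "moment n S m t0" for m t0
    proof (cases m)
      case 0
      \<comment> \<open>Before the first insertion nothing is stored; it remains to see that the
        logarithm is nonnegative.\<close>
      have "1 \<le> sum w {..<n} / \<delta>" using assms(3-5) by (simp add: field_simps)
      then show ?thesis by (simp add: 0 stored_def unexpired_def)
    next
      case (Suc l)
      then have "l < n" using m by (simp add: moment_def)
      then have "real (N (unexpired E (S l) {..<Suc l}) \<omega>) \<le> b"
        using \<omega> by (auto simp: Bad_def not_less)
      moreover have "(\<Sum>c<k. card (stored S E (copy c \<omega>) m t0)) \<le> N (unexpired E (S l) {..<Suc l}) \<omega>"
        unfolding N_def Suc using card_stored_le[OF assms(1)] m Suc by (intro sum_mono) auto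
      ultimately show ?thesis unfolding b_def by linarith
    qed
  qed
  finally show ?thesis .
qed

end

section \<open>The sampling and size guarantees combined\<close>

theorem theorem6p9:
  "\<exists>C::real. 0 < C \<and>
     (\<forall>(n::nat) (S::nat \<Rightarrow> real) (E::nat \<Rightarrow> real) (w::nat \<Rightarrow> real) (k::nat) (\<delta>::real).
        expiration_stream n S E \<and> (\<forall>i<n. 1 \<le> w i) \<and> 2 \<le> (\<Sum>i<n. w i) \<and> 0 < \<delta> \<and> \<delta> < 1 \<longrightarrow>
        (\<forall>m t0 t. moment n S m t0 \<and> t0 \<le> t \<and> active S E m t \<noteq> {} \<longrightarrow>
           prob_space.indep_vars (priorities k n w) (\<lambda>_. count_space UNIV)
             (\<lambda>c \<omega>. query S E (copy c \<omega>) m t0 t) {..<k} \<and>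
           (\<forall>c<k. \<forall>i\<in>active S E m t.
              measure (priorities k n w)
                {\<omega> \<in> space (priorities k n w). query S E (copy c \<omega>) m t0 t = i}
              = w i / (\<Sum>j\<in>active S E m t. w j))) \<and>
        1 - \<delta> \<le> measure (priorities k n w)
          {\<omega> \<in> space (priorities k n w). \<forall>m t0. moment n S m t0 \<longrightarrow>
             real (\<Sum>c<k. card (stored S E (copy c \<omega>) m t0))
             \<le> C * real k * ln ((\<Sum>i<n. w i) / \<delta>)})"
proof (intro exI[of _ "3 / ln 2"] conjI allI ballI impI; (elim conjE)?)
  fix n k :: nat and S E w :: "nat \<Rightarrow> real" and \<delta> :: real
  assume stream: "expiration_stream n S E" and w1: "\<forall>i<n. 1 \<le> w i" and W: "2 \<le> (\<Sum>i<n. w i)"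
    and \<delta>: "0 < \<delta>" "\<delta> < 1"
  \<comment> \<open>The weights \<open>w i\<close> with \<open>i \<ge> n\<close> are unconstrained and need not be rates.\<close>
  define v where "v i = (if i < n then w i else 1)" for i
  interpret exponential_priorities v
    by standard (use w1 in \<open>auto simp: v_def intro: less_le_trans[OF zero_less_one]\<close>)
  have priorities: "priorities k n w = priorities k n v"
    unfolding priorities_def by (intro PiM_cong) (auto simp: v_def)
  have sum_v: "sum w A = sum v A" if "A \<subseteq> {..<n}" for A
    using that by (intro sum.cong) (auto simp: v_def)
  show "1 - \<delta> \<le> measure (priorities k n w)
      {\<omega> \<in> space (priorities k n w). \<forall>m t0. moment n S m t0 \<longrightarrow>
         real (\<Sum>c<k. card (stored S E (copy c \<omega>) m t0)) \<le> 3 / ln 2 * real k * ln ((\<Sum>i<n. w i) / \<delta>)}"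
    unfolding priorities sum_v[OF order.refl]
  proof (rule size_bound[OF stream _ _ \<delta>])
    show "2 \<le> sum v {..<n}" using W sum_v[of "{..<n}"] by simp
  qed (use w1 in \<open>simp add: v_def\<close>)
  fix m t0 t
  assume m: "moment n S m t0" "t0 \<le> t" and ne: "active S E m t \<noteq> {}"
  have A: "active S E m t \<subseteq> {..<n}" using m by (auto simp: active_def moment_def)
  have n: "0 < n" using A ne by auto
  have query: "query S E p m t0 t = arg_min p (\<lambda>x. x \<in> active S E m t)" for p
    using stream m by (rule query_eq_arg_min)
  show "prob_space.indep_vars (priorities k n w) (\<lambda>_. count_space UNIV)
      (\<lambda>c \<omega>. query S E (copy c \<omega>) m t0 t) {..<k}"
    unfolding query priorities using A n by (rule indep_vars_arg_min)
  show "measure (priorities k n w) {\<omega> \<in> space (priorities k n w). query S E (copy c \<omega>) m t0 t = i}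
      = w i / (\<Sum>j\<in>active S E m t. w j)" if "c < k" "i \<in> active S E m t" for c i
    using measure_arg_min[OF A that] A that(2) by (auto simp: query priorities sum_v v_def)
qed simp

end
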